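(* Let $\chi,\mu$ be probability measures on $\mathbb{R}$, let $\ddot\mu$ be a symmetrization of $\mu$, let $\mathfrak{D}(\cdot,m)$, $m\in\mathbb{N}_0$, be the associated deconvolution function and let $\Phi_{\mathfrak{D}}(t,m) := \int_{-\infty}^{\infty} e^{itx}\,\mathfrak{D}(dx,m)$ be its Fourier-Stieltjes transform. Then $\|\Phi_{\mathfrak{D}}(\cdot,m)\|_\infty \le 1$ for all $m \in \mathbb{N}_0$, and the following hold. (1) If $t \in \mathbb{R}\setminus \mathcal{N}_\mu$ or $t \in \mathcal{N}_\mu \cap \mathcal{N}_\chi$ (with $t\in\mathbb{R}$), then $\lim_{m\to\infty} |\Phi_{\mathfrak{D}}(t,m) - \Phi_\chi(t)| = 0$. The convergence is uniform on any compact interval $I \subset \mathbb{R}$ with $I \cap \mathcal{N}_\mu \subseteq \mathcal{N}_\chi$. (2) If $\mathcal{N}_\mu \subseteq \mathcal{N}_\chi$ and $\pm\infty \in \mathcal{N}_\chi$, then $\lim_{m\to\infty} \|\Phi_{\mathfrak{D}}(\cdot,m) - \Phi_\chi\|_\infty = 0$.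
   Context: Measures are finite signed Borel measures on $\mathbb{R}$. $F_\nu(\xi) := \nu((-\infty,\xi])$, $\Phi_\nu(t) := \int e^{itx}\,\nu(dx)$, and $\mathcal{N}_\nu := \{t \in \mathbb{R}\cup\{\pm\infty\} : \Phi_\nu(t)=0\}$, where $\pm\infty \in \mathcal{N}_\nu$ means $\lim_{t\to\pm\infty}\Phi_\nu(t)=0$. $\nu^{*0}:=\delta_{\{0\}}$, $\nu^{*k} := \nu * \nu^{*(k-1)}$, and $F_\nu^{*k}$ is the distribution function of $\nu^{*k}$. A symmetrization of $\mu$ is a probability measure $\ddot\mu = \mu*\eta$, with $\eta$ a probability measure, such that $F_{\ddot\mu}(\xi-)=1-F_{\ddot\mu}(-\xi)$ for all $\xi$, $\Phi_{\ddot\mu}=\Phi_\mu\Phi_\eta$ is even with $0\le\Phi_{\ddot\mu}\le1$, and $\mathcal{N}_{\ddot\mu}=\mathcal{N}_\mu$. Put $\pi_{\ddot\mu} := \delta_{\{0\}} - \ddot\mu$. The deconvolution kernel is $\mathfrak{K}_{\ddot\mu}(\xi,m) := \sum_{\ell=0}^m F_{\pi_{\ddot\mu}}^{*\ell}(\xi)$ and the deconvolution function is $\mathfrak{D}(\xi,m) := (F_{\chi*\ddot\mu} * \mathfrak{K}_{\ddot\mu}(\cdot,m))(\xi) = \int_{\mathbb{R}} F_{\chi*\ddot\mu}(\xi-x)\,\mathfrak{K}_{\ddot\mu}(dx,m)$, for $(\xi,m)\in\mathbb{R}\times\mathbb{N}_0$. $\|\cdot\|_\infty$ is the supremum norm on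 $\mathbb{R}$. *)

theory Defs
  imports "HOL-Probability.Probability"
begin

text \<open>
  A finite signed Borel measure on the reals is a countably additive set function on the Borel sets.
  It is given the value 0 off the Borel sets, as \<^const>\<open>measure\<close> does, so that
  \<^term>\<open>measure M\<close> is such a set function for every finite Borel measure \<^term>\<open>M\<close>, and so that
  signed measures agreeing on the Borel sets are equal. Countable additivity implies that the empty
  set has measure 0.
\<close>

definition finite_signed_measure :: "(real set \<Rightarrow> real) \<Rightarrow> bool" where
  "finite_signed_measure \<nu> \<longleftrightarrow>
     (\<forall>A. A \<notin> sets borel \<longrightarrow> \<nu> A = 0) \<and>
     (\<forall>A :: nat \<Rightarrow> real set. range A \<subseteq> sets borel \<longrightarrow> disjoint_family A \<longrightarrow>
        (\<lambda>i. \<nu> (A i)) sums \<nu> (\<Union>i. A i))"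

text \<open>
  The Jordan decomposition: the positive part of \<^term>\<open>\<nu>\<close> is its upper variation, the negative part
  is the upper variation of \<^term>\<open>\<lambda>A. - \<nu> A\<close>.
\<close>

definition upper_variation :: "(real set \<Rightarrow> real) \<Rightarrow> real measure" where
  "upper_variation \<nu> =
     measure_of UNIV (sets borel) (\<lambda>A. ennreal (SUP B\<in>{B \<in> sets borel. B \<subseteq> A}. \<nu> B))"

definition signed_integral ::
    "(real set \<Rightarrow> real) \<Rightarrow> (real \<Rightarrow> 'b) \<Rightarrow> 'b :: {banach, second_countable_topology}" where
  "signed_integral \<nu> f =
     (\<integral>x. f x \<partial>upper_variation \<nu>) - (\<integral>x. f x \<partial>upper_variation (\<lambda>A. - \<nu> A))"

definition signed_cdf :: "(real set \<Rightarrow> real) \<Rightarrow> real \<Rightarrow> real" where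
  "signed_cdf \<nu> \<xi> = \<nu> {..\<xi>}"

definition signed_convolution ::
    "(real set \<Rightarrow> real) \<Rightarrow> (real set \<Rightarrow> real) \<Rightarrow> real set \<Rightarrow> real" where
  "signed_convolution \<nu> \<rho> A = signed_integral \<rho> (\<lambda>x. \<nu> {y. x + y \<in> A})"

primrec convolution_power :: "(real set \<Rightarrow> real) \<Rightarrow> nat \<Rightarrow> real set \<Rightarrow> real" where
  "convolution_power \<nu> 0 = measure (return borel 0)"
| "convolution_power \<nu> (Suc k) = signed_convolution \<nu> (convolution_power \<nu> k)"

text \<open>
  The Lebesgue-Stieltjes integral of \<^term>\<open>f\<close> with respect to a function \<^term>\<open>F\<close> is the integral
  with respect to the finite signed measure that has \<^term>\<open>F\<close> as its distribution function. Such a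
  measure is unique if it exists.
\<close>

definition stieltjes_measure :: "(real \<Rightarrow> real) \<Rightarrow> real set \<Rightarrow> real" where
  "stieltjes_measure F = (THE \<nu>. finite_signed_measure \<nu> \<and> signed_cdf \<nu> = F)"

definition stieltjes_integral ::
    "(real \<Rightarrow> 'b) \<Rightarrow> (real \<Rightarrow> real) \<Rightarrow> 'b :: {banach, second_countable_topology}" where
  "stieltjes_integral f F = signed_integral (stieltjes_measure F) f"

definition char_zeros :: "real measure \<Rightarrow> ereal set" where
  "char_zeros M =
     {ereal t | t. char M t = 0} \<union>
     {s. s = \<infinity> \<and> (char M \<longlongrightarrow> 0) at_top} \<union>
     {s. s = -\<infinity> \<and> (char M \<longlongrightarrow> 0) at_bot}"

definition symmetrization :: "real measure \<Rightarrow> real measure \<Rightarrow> bool" where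
  "symmetrization \<mu> \<mu>s \<longleftrightarrow>
     real_distribution \<mu>s \<and>
     (\<exists>\<eta>. real_distribution \<eta> \<and> \<mu>s = (\<mu> \<star> \<eta>) \<and> (\<forall>t. char \<mu>s t = char \<mu> t * char \<eta> t)) \<and>
     (\<forall>\<xi>. (cdf \<mu>s \<longlongrightarrow> 1 - cdf \<mu>s (- \<xi>)) (at_left \<xi>)) \<and>
     (\<forall>t. char \<mu>s (- t) = char \<mu>s t) \<and>
     (\<forall>t. \<exists>r. char \<mu>s t = complex_of_real r \<and> 0 \<le> r \<and> r \<le> 1) \<and>
     char_zeros \<mu>s = char_zeros \<mu>"

definition delta_minus :: "real measure \<Rightarrow> real set \<Rightarrow> real" where
  "delta_minus \<mu>s A = measure (return borel 0) A - measure \<mu>s A"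

definition deconvolution_kernel :: "real measure \<Rightarrow> real \<Rightarrow> nat \<Rightarrow> real" where
  "deconvolution_kernel \<mu>s \<xi> m = (\<Sum>l\<le>m. signed_cdf (convolution_power (delta_minus \<mu>s) l) \<xi>)"

definition deconvolution_function ::
    "real measure \<Rightarrow> real measure \<Rightarrow> real \<Rightarrow> nat \<Rightarrow> real" where
  "deconvolution_function chi \<mu>s \<xi> m =
     stieltjes_integral (\<lambda>x. cdf (chi \<star> \<mu>s) (\<xi> - x)) (\<lambda>x. deconvolution_kernel \<mu>s x m)"

definition deconvolution_transform ::
    "real measure \<Rightarrow> real measure \<Rightarrow> real \<Rightarrow> nat \<Rightarrow> complex" where
  "deconvolution_transform chi \<mu>s t m =
     stieltjes_integral (\<lambda>x. iexp (t * x)) (\<lambda>x. deconvolution_function chi \<mu>s x m)"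

text \<open>The supremum is taken in the extended reals, so that unbounded functions have norm \<^term>\<open>\<infinity>\<close>.\<close>

definition sup_norm :: "(real \<Rightarrow> complex) \<Rightarrow> ereal" where
  "sup_norm f = (SUP t. ereal (cmod (f t)))"

end

theory Submission
  imports Defs
begin

text \<open>
  Convolution becomes multiplication under the Fourier-Stieltjes transform, and
  \<open>\<delta>\<^sub>0 - \<mu>s\<close> has the transform \<open>1 - char \<mu>s\<close>. Hence the deconvolution kernel has the transform
  \<open>\<Sum>l\<le>m. (1 - char \<mu>s t)\<^sup>l\<close>, a truncated geometric series for \<open>1 / char \<mu>s t\<close>, and the deconvolution
  function, which is the distribution function of \<open>chi \<star> \<mu>s\<close> convolved with the kernel, has the transform
  \<open>char chi t * (1 - (1 - char \<mu>s t)\<^sup>m\<^sup>+\<^sup>1)\<close> (lemma \<open>deconvolution_transform_eq\<close>).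

  A symmetrization has a real characteristic function \<open>v\<close> with values in the unit interval, so this product
  has modulus at most \<open>\<bar>char chi t\<bar> \<le> 1\<close>, and the error is \<open>\<bar>char chi t\<bar> (1 - v t)\<^sup>m\<^sup>+\<^sup>1\<close>. Given
  \<open>e > 0\<close>, the error is below \<open>e\<close> wherever \<open>\<bar>char chi t\<bar> < e\<close>. On the set of the other \<open>t\<close> the function
  \<open>v\<close> has no zero, since the zeros of \<open>v\<close> are zeros of \<open>char chi\<close>; if that set is compact, then \<open>v\<close> is
  bounded below there by some \<open>\<delta> > 0\<close>, and the error is at most \<open>(1 - \<delta>)\<^sup>m\<^sup>+\<^sup>1\<close>. This is lemma
  \<open>uniform_limit_mult_one_minus_power\<close>. It is applied to a single point, to a compact interval, and to the
  whole line, where compactness comes from the decay of \<open>char chi\<close> at infinity.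

  The measure-theoretic part makes the first paragraph rigorous for integrals defined by Jordan
  decompositions and for measures recovered from their distribution functions. Every signed measure that
  occurs is a difference of two finite positive measures \<open>P\<close> and \<open>N\<close>. Integration against it does not
  depend on the choice of \<open>P\<close> and \<open>N\<close> (lemma \<open>signed_integral_difference\<close>), so transforms can be computed
  without knowing any Jordan decomposition explicitly. A finite signed measure is determined by its
  distribution function (lemma \<open>signed_cdf_unique\<close>), so the measures behind the kernel and the
  deconvolution function are the expected sums and convolutions.
\<close>

section \<open>Sums of finite Borel measures\<close>

lemma finite_borel_measureI:
  assumes "sets M = sets borel" and "emeasure M UNIV \<noteq> \<infinity>"
  shows "finite_borel_measure M"
  using assms sets_eq_imp_space_eq[OF assms(1)]
  by (intro finite_borel_measure.intro finite_borel_measure_axioms.intro finite_measureI) auto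

definition add_measure :: "real measure \<Rightarrow> real measure \<Rightarrow> real measure" where
  "add_measure P N = measure_of UNIV (sets borel) (\<lambda>A. emeasure P A + emeasure N A)"

lemma sets_add_measure [simp]: "sets (add_measure P N) = sets borel"
  using sets.sets_measure_of_eq[of "borel :: real measure"] by (simp add: add_measure_def)

lemma emeasure_add_measure:
  assumes "finite_borel_measure P" "finite_borel_measure N" and A: "A \<in> sets borel"
  shows "emeasure (add_measure P N) A = emeasure P A + emeasure N A"
proof (rule emeasure_measure_of[OF add_measure_def])
  interpret P: finite_borel_measure P by fact
  interpret N: finite_borel_measure N by fact
  show "countably_additive (sets (add_measure P N)) (\<lambda>A. emeasure P A + emeasure N A)"
  proof (rule countably_additiveI)
    fix A :: "nat \<Rightarrow> real set"
    assume A: "range A \<subseteq> sets (add_measure P N)" "disjoint_family A"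
    have "(\<Sum>i. emeasure P (A i) + emeasure N (A i)) = (\<Sum>i. emeasure P (A i)) + (\<Sum>i. emeasure N (A i))"
      by (rule suminf_add[symmetric]) auto
    also have "\<dots> = emeasure P (\<Union>i. A i) + emeasure N (\<Union>i. A i)"
      using A by (subst (1 2) suminf_emeasure) (auto simp: P.M_is_borel N.M_is_borel)
    finally show "(\<Sum>i. emeasure P (A i) + emeasure N (A i)) =
      emeasure P (\<Union>i. A i) + emeasure N (\<Union>i. A i)" .
  qed
qed (use A in \<open>auto simp: positive_def\<close>)

lemma finite_borel_measure_add_measure:
  assumes "finite_borel_measure P" "finite_borel_measure N"
  shows "finite_borel_measure (add_measure P N)"
proof -
  interpret P: finite_borel_measure P by fact
  interpret N: finite_borel_measure N by fact
  show ?thesis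
    by (rule finite_borel_measureI)
      (simp_all add: emeasure_add_measure[OF assms] P.emeasure_finite N.emeasure_finite)
qed

lemma measure_add_measure:
  assumes "finite_borel_measure P" "finite_borel_measure N" and A: "A \<in> sets borel"
  shows "measure (add_measure P N) A = measure P A + measure N A"
proof -
  interpret P: finite_borel_measure P by fact
  interpret N: finite_borel_measure N by fact
  show ?thesis
    using emeasure_add_measure[OF assms]
    by (simp add: P.emeasure_eq_measure N.emeasure_eq_measure measure_def[of "add_measure P N"]
        ennreal_plus[symmetric] del: ennreal_plus)
qed

text \<open>
  The integrability conclusions belong to the induction: the two integrals on the right are additive in
  \<open>f\<close> only where they exist. In the passage to the limit they exist because both measures are bounded
  by their sum.
\<close>
lemma integral_add_measure:
  fixes f :: "real \<Rightarrow> 'b :: {banach, second_countable_topology}"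
  assumes P: "finite_borel_measure P" and N: "finite_borel_measure N"
    and f: "integrable (add_measure P N) f"
  shows "integrable P f \<and> integrable N f \<and>
    (\<integral>x. f x \<partial>add_measure P N) = (\<integral>x. f x \<partial>P) + (\<integral>x. f x \<partial>N)"
proof -
  let ?S = "add_measure P N"
  interpret P: finite_borel_measure P by fact
  interpret N: finite_borel_measure N by fact
  interpret S: finite_borel_measure ?S by (rule finite_borel_measure_add_measure[OF P N])
  note [measurable_cong] = P.M_is_borel N.M_is_borel S.M_is_borel
  have le: "integrable M g" if M: "M = P \<or> M = N" and g: "integrable ?S g"
    for M and g :: "real \<Rightarrow> 'b"
  proof -
    have sets: "sets M = sets ?S" using M P.M_is_borel N.M_is_borel by auto
    have "M \<le> ?S"
      using M sets by (auto simp: le_measure emeasure_add_measure[OF P N] le_fun_def)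
    then have "(\<integral>\<^sup>+x. norm (g x) \<partial>M) \<le> (\<integral>\<^sup>+x. norm (g x) \<partial>?S)"
      by (intro nn_integral_mono_measure sets)
    moreover have "g \<in> borel_measurable M"
      using borel_measurable_integrable[OF g] by (simp only: measurable_cong_sets[OF sets refl])
    moreover have "(\<integral>\<^sup>+x. norm (g x) \<partial>?S) < \<infinity>"
      using g by (simp add: integrable_iff_bounded)
    ultimately show ?thesis
      unfolding integrable_iff_bounded by (metis le_less_trans)
  qed
  from f show ?thesis
  proof (induct rule: integrable_induct)
    case (base A c)
    then have [measurable]: "A \<in> sets borel" by simp
    show ?case
      by (simp add: measure_add_measure[OF P N] P.M_is_borel N.M_is_borel
          P.emeasure_finite N.emeasure_finite less_top[symmetric] scaleR_add_left)
  next
    case (add f g)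
    then show ?case by (simp add: algebra_simps)
  next
    case (lim f s)
    have meas: "f \<in> borel_measurable borel" "\<And>i. s i \<in> borel_measurable borel"
      using borel_measurable_integrable[OF lim(5)] borel_measurable_integrable[OF lim(1)] by simp_all
    have conv: "(\<lambda>i. \<integral>x. s i x \<partial>M) \<longlonglongrightarrow> (\<integral>x. f x \<partial>M)"
      if M: "M \<in> {P, N, ?S}" for M
    proof (rule integral_dominated_convergence[where w = "\<lambda>x. 2 * norm (f x)"])
      show "integrable M (\<lambda>x. 2 * norm (f x))" using M lim(5) le[of M f] by auto
      show "f \<in> borel_measurable M" "\<And>i. s i \<in> borel_measurable M"
        using M meas by auto
      have "space M = space ?S" using M P.borel_UNIV N.borel_UNIV S.borel_UNIV by auto
      then show "AE x in M. (\<lambda>i. s i x) \<longlonglongrightarrow> f x"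
        "\<And>i. AE x in M. norm (s i x) \<le> 2 * norm (f x)"
        using lim(3,4) by auto
    qed
    have "(\<lambda>i. \<integral>x. s i x \<partial>?S) \<longlonglongrightarrow> (\<integral>x. f x \<partial>P) + (\<integral>x. f x \<partial>N)"
      using tendsto_add[OF conv[of P] conv[of N]] lim(2) by simp
    with conv[of ?S] have "(\<integral>x. f x \<partial>?S) = (\<integral>x. f x \<partial>P) + (\<integral>x. f x \<partial>N)"
      by (auto intro: LIMSEQ_unique)
    then show ?case using lim(5) le[of P f] le[of N f] by auto
  qed
qed

lemma (in finite_borel_measure) integrable_bounded:
  fixes f :: "real \<Rightarrow> 'b :: {banach, second_countable_topology}"
  assumes f: "f \<in> borel_measurable borel" and B: "\<And>x. norm (f x) \<le> B"
  shows "integrable M f"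
proof (rule integrable_const_bound)
  show "f \<in> borel_measurable M" using f by (simp add: measurable_cong_sets[OF M_is_borel refl])
qed (use B in auto)

section \<open>Finite signed measures\<close>

lemma finite_signed_measureD:
  assumes "finite_signed_measure \<nu>"
  shows "A \<notin> sets borel \<Longrightarrow> \<nu> A = 0"
    and "range B \<subseteq> sets borel \<Longrightarrow> disjoint_family B \<Longrightarrow> (\<lambda>i. \<nu> (B i)) sums \<nu> (\<Union>i. B i)"
  using assms by (auto simp: finite_signed_measure_def)

lemma finite_signed_measure_empty:
  assumes "finite_signed_measure \<nu>"
  shows "\<nu> {} = 0"
proof -
  have "(\<lambda>i::nat. \<nu> {}) sums \<nu> (\<Union>i::nat. {})"
    by (rule finite_signed_measureD(2)[OF assms]) (auto simp: disjoint_family_on_def)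
  then have "summable (\<lambda>i::nat. \<nu> {})" by (rule sums_summable)
  then show ?thesis by (auto dest: summable_LIMSEQ_zero simp: LIMSEQ_const_iff)
qed

lemma finite_signed_measure_Un:
  assumes \<nu>: "finite_signed_measure \<nu>"
    and A: "A \<in> sets borel" and B: "B \<in> sets borel" and disj: "A \<inter> B = {}"
  shows "\<nu> (A \<union> B) = \<nu> A + \<nu> B"
proof -
  have "(\<lambda>i. \<nu> (binaryset A B i)) sums \<nu> (\<Union>i. binaryset A B i)"
    using A B disj by (intro finite_signed_measureD(2)[OF \<nu>])
      (auto simp: range_binaryset_eq disjoint_family_on_def binaryset_def)
  then show ?thesis
    using binaryset_sums[of \<nu> A B] finite_signed_measure_empty[OF \<nu>]
    by (auto simp: UN_binaryset_eq intro: sums_unique2)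
qed

lemma finite_signed_measure_uminus:
  "finite_signed_measure \<nu> \<Longrightarrow> finite_signed_measure (\<lambda>A. - \<nu> A)"
  by (auto simp: finite_signed_measure_def intro: sums_minus)

text \<open>
  The sets on which the two measures agree contain the rays, an intersection-stable generator of the
  Borel sets, and are closed under countable disjoint unions. Closure under complements needs equal total
  masses, which countable additivity provides after cutting the line into one ray and countably many
  bounded intervals.
\<close>
lemma signed_cdf_unique:
  assumes \<nu>: "finite_signed_measure \<nu>" and \<rho>: "finite_signed_measure \<rho>"
    and cdf: "signed_cdf \<nu> = signed_cdf \<rho>"
  shows "\<nu> = \<rho>"
proof
  fix A :: "real set"
  have atMost: "\<nu> {..x} = \<rho> {..x}" for x
    using cdf by (simp add: signed_cdf_def fun_eq_iff)
  have Ioc: "\<nu> {x<..y} = \<rho> {x<..y}" if "x \<le> y" for x y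
  proof -
    have "{..y} = {..x} \<union> {x<..y}" using that by auto
    then show ?thesis
      using finite_signed_measure_Un[OF \<nu>, of "{..x}" "{x<..y}"]
        finite_signed_measure_Un[OF \<rho>, of "{..x}" "{x<..y}"] atMost[of x] atMost[of y] by force
  qed
  \<comment> \<open>A partition of the line into sets whose measures are known to agree.\<close>
  define B :: "nat \<Rightarrow> real set" where
    "B = (\<lambda>n. case n of 0 \<Rightarrow> {..0} | Suc k \<Rightarrow> {real k<..real (Suc k)})"
  have B: "range B \<subseteq> sets borel" "disjoint_family B"
    by (auto simp: B_def disjoint_family_on_def split: nat.splits)
  have UN_B: "(\<Union>n. B n) = UNIV"
  proof -
    have "x \<in> (\<Union>n. B n)" for x
    proof (cases "x \<le> 0")
      case True
      then have "x \<in> B 0" by (simp add: B_def)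
      then show ?thesis by blast
    next
      case False
      define k where "k = nat \<lceil>x\<rceil> - 1"
      have "real k < x" "x \<le> real (Suc k)"
        using False unfolding k_def by linarith+
      then have "x \<in> B (Suc k)" by (simp add: B_def)
      then show ?thesis by blast
    qed
    then show ?thesis by blast
  qed
  have "\<nu> (B n) = \<rho> (B n)" for n
    by (cases n) (simp_all add: B_def atMost Ioc)
  then have UNIV: "\<nu> UNIV = \<rho> UNIV"
    using finite_signed_measureD(2)[OF \<nu> B] finite_signed_measureD(2)[OF \<rho> B]
    by (auto simp: UN_B intro: sums_unique2)
  show "\<nu> A = \<rho> A"
  proof (cases "A \<in> sets borel")
    case False
    then show ?thesis
      by (simp add: finite_signed_measureD(1)[OF \<nu>] finite_signed_measureD(1)[OF \<rho>])
  next
    case True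
    have sets: "sets borel = sigma_sets UNIV (range (\<lambda>x::real. {..x}))"
      by (subst borel_eq_atMost) simp
    have "Int_stable (range (\<lambda>x::real. {..x}))"
      by (auto simp: Int_stable_def)
    moreover have "range (\<lambda>x::real. {..x}) \<subseteq> Pow UNIV" by simp
    moreover have "A \<in> sigma_sets UNIV (range (\<lambda>x::real. {..x}))"
      using True sets by simp
    ultimately show ?thesis
    proof (induction rule: sigma_sets_induct_disjoint)
      case (compl A)
      then have "A \<in> sets borel" by (simp add: sets)
      then have "\<nu> UNIV = \<nu> A + \<nu> (UNIV - A)" "\<rho> UNIV = \<rho> A + \<rho> (UNIV - A)"
        using finite_signed_measure_Un[OF \<nu>, of A "UNIV - A"]
          finite_signed_measure_Un[OF \<rho>, of A "UNIV - A"] by auto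
      then show ?case using UNIV compl by simp
    next
      case (union A)
      then have "range A \<subseteq> sets borel" by (simp add: sets)
      then show ?case
        using finite_signed_measureD(2)[OF \<nu>, of A] finite_signed_measureD(2)[OF \<rho>, of A] union
        by (auto intro: sums_unique2)
    qed (auto simp: atMost finite_signed_measure_empty[OF \<nu>] finite_signed_measure_empty[OF \<rho>])
  qed
qed

lemma stieltjes_measure_signed_cdf:
  assumes "finite_signed_measure \<nu>"
  shows "stieltjes_measure (signed_cdf \<nu>) = \<nu>"
  unfolding stieltjes_measure_def using assms signed_cdf_unique by (intro the_equality) auto

text \<open>
  If \<open>X\<close> is a positive set with negative complement, then \<open>A \<inter> X\<close> attains the supremum that defines the
  upper variation of \<open>A\<close>: discarding from a subset \<open>B\<close> the part outside \<open>X\<close>, and then adding the rest of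
  \<open>A \<inter> X\<close>, can only increase the value. This turns the supremum into a countably additive function.
\<close>
lemma upper_variation_Hahn:
  assumes \<nu>: "finite_signed_measure \<nu>" and X: "X \<in> sets borel"
    and pos: "\<And>A. A \<in> sets borel \<Longrightarrow> A \<subseteq> X \<Longrightarrow> 0 \<le> \<nu> A"
    and neg: "\<And>A. A \<in> sets borel \<Longrightarrow> A \<inter> X = {} \<Longrightarrow> \<nu> A \<le> 0"
  shows "finite_borel_measure (upper_variation \<nu>)"
    and "A \<in> sets borel \<Longrightarrow> emeasure (upper_variation \<nu>) A = ennreal (\<nu> (A \<inter> X))"
proof -
  have sup: "(SUP B\<in>{B \<in> sets borel. B \<subseteq> A}. \<nu> B) = \<nu> (A \<inter> X)" if A: "A \<in> sets borel" for A
  proof (rule cSup_eq_maximum)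
    show "\<nu> (A \<inter> X) \<in> \<nu> ` {B \<in> sets borel. B \<subseteq> A}" using A X by blast
    fix y assume "y \<in> \<nu> ` {B \<in> sets borel. B \<subseteq> A}"
    then obtain B where B: "B \<in> sets borel" "B \<subseteq> A" "y = \<nu> B" by auto
    have "\<nu> B = \<nu> (B \<inter> X) + \<nu> (B - X)"
      using finite_signed_measure_Un[OF \<nu>, of "B \<inter> X" "B - X"] B X
      by (auto simp: Int_Diff_Un)
    also have "\<dots> \<le> \<nu> (B \<inter> X)" using neg[of "B - X"] B X by auto
    also have "\<dots> \<le> \<nu> (B \<inter> X) + \<nu> ((A - B) \<inter> X)" using pos[of "(A - B) \<inter> X"] A B X by auto
    also have "\<dots> = \<nu> ((B \<inter> X) \<union> ((A - B) \<inter> X))"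
      using A B X by (intro finite_signed_measure_Un[OF \<nu>, symmetric]) auto
    also have "(B \<inter> X) \<union> ((A - B) \<inter> X) = A \<inter> X" using B by auto
    finally show "y \<le> \<nu> (A \<inter> X)" using B by simp
  qed
  let ?g = "\<lambda>A. ennreal (SUP B\<in>{B \<in> sets borel. B \<subseteq> A}. \<nu> B)"
  have sets: "sets (upper_variation \<nu>) = sets borel"
    using sets.sets_measure_of_eq[of "borel :: real measure"] by (simp add: upper_variation_def)
  have em: "emeasure (upper_variation \<nu>) A = ennreal (\<nu> (A \<inter> X))" if A: "A \<in> sets borel" for A
  proof -
    have "emeasure (upper_variation \<nu>) A = ?g A"
    proof (rule emeasure_measure_of[OF upper_variation_def])
      show "positive (sets (upper_variation \<nu>)) ?g"
        using sup[of "{}"] finite_signed_measure_empty[OF \<nu>] by (simp add: positive_def)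
      show "countably_additive (sets (upper_variation \<nu>)) ?g"
      proof (rule countably_additiveI)
        fix A :: "nat \<Rightarrow> real set"
        assume A: "range A \<subseteq> sets (upper_variation \<nu>)" "disjoint_family A"
          "(\<Union>i. A i) \<in> sets (upper_variation \<nu>)"
        then have Ai: "A i \<in> sets borel" for i using sets by auto
        have "(\<lambda>i. \<nu> (A i \<inter> X)) sums \<nu> (\<Union>i. A i \<inter> X)"
          using A Ai X by (intro finite_signed_measureD(2)[OF \<nu>]) (auto simp: disjoint_family_on_def)
        then have "(\<Sum>i. ennreal (\<nu> (A i \<inter> X))) = ennreal (\<nu> (\<Union>i. A i \<inter> X))"
          using Ai X by (intro suminf_ennreal_eq pos) auto
        then show "(\<Sum>i. ?g (A i)) = ?g (\<Union>i. A i)"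
          using Ai A(3) sets by (simp add: sup del: UN_simps) (simp add: UN_simps)
      qed
    qed (use A sets in auto)
    then show ?thesis using sup[OF A] by simp
  qed
  show "finite_borel_measure (upper_variation \<nu>)"
    by (rule finite_borel_measureI[OF sets]) (simp add: em)
  show "A \<in> sets borel \<Longrightarrow> emeasure (upper_variation \<nu>) A = ennreal (\<nu> (A \<inter> X))"
    by (rule em)
qed

section \<open>Differences of finite measures\<close>

text \<open>
  The measures \<open>P\<close> and \<open>N\<close> may overlap, unlike the two parts of a Jordan decomposition. This freedom makes
  the notion stable under sums and convolutions.
\<close>
definition measure_difference ::
    "(real set \<Rightarrow> real) \<Rightarrow> real measure \<Rightarrow> real measure \<Rightarrow> bool" where
  "measure_difference \<nu> P N \<longleftrightarrow> finite_borel_measure P \<and> finite_borel_measure N \<and>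
     \<nu> = (\<lambda>A. measure P A - measure N A)"

lemma finite_signed_measure_difference:
  assumes "measure_difference \<nu> P N"
  shows "finite_signed_measure \<nu>"
proof -
  have P: "finite_borel_measure P" and N: "finite_borel_measure N"
    and \<nu>: "\<nu> = (\<lambda>A. measure P A - measure N A)"
    using assms by (auto simp: measure_difference_def)
  interpret P: finite_borel_measure P by fact
  interpret N: finite_borel_measure N by fact
  show ?thesis
    unfolding finite_signed_measure_def \<nu>
  proof (intro conjI allI impI)
    fix A :: "real set" assume "A \<notin> sets borel"
    then show "measure P A - measure N A = 0"
      by (simp add: measure_notin_sets P.M_is_borel N.M_is_borel)
  next
    fix A :: "nat \<Rightarrow> real set" assume "range A \<subseteq> sets borel" "disjoint_family A"
    then show "(\<lambda>i. measure P (A i) - measure N (A i)) sums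
      (measure P (\<Union>i. A i) - measure N (\<Union>i. A i))"
      by (intro sums_diff P.finite_measure_UNION N.finite_measure_UNION)
        (auto simp: P.M_is_borel N.M_is_borel)
  qed
qed

text \<open>
  Let \<open>U\<close> and \<open>V\<close> be the positive and the negative part of \<open>\<nu>\<close>. From \<open>U - V = P - N\<close> follows the
  equality \<open>U + N = V + P\<close> of positive measures, and integrating \<open>f\<close> against both sides gives the claim.
  The Hahn set behind \<open>U\<close> and \<open>V\<close> is one on which \<open>P\<close> dominates \<open>N\<close>.
\<close>
lemma signed_integral_difference:
  fixes f :: "real \<Rightarrow> 'b :: {banach, second_countable_topology}"
  assumes diff: "measure_difference \<nu> P N"
    and f: "f \<in> borel_measurable borel" and B: "\<And>x. norm (f x) \<le> B"
  shows "signed_integral \<nu> f = (\<integral>x. f x \<partial>P) - (\<integral>x. f x \<partial>N)"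
proof -
  have P: "finite_borel_measure P" and N: "finite_borel_measure N"
    and \<nu>: "\<nu> = (\<lambda>A. measure P A - measure N A)"
    using diff by (auto simp: measure_difference_def)
  interpret P: finite_borel_measure P by fact
  interpret N: finite_borel_measure N by fact
  note sgn = finite_signed_measure_difference[OF diff]
  let ?U = "upper_variation \<nu>" and ?V = "upper_variation (\<lambda>A. - \<nu> A)"
  obtain X where X: "X \<in> sets borel"
    and XP: "\<And>A. A \<in> sets borel \<Longrightarrow> A \<subseteq> X \<Longrightarrow> emeasure N A \<le> emeasure P A"
    and XN: "\<And>A. A \<in> sets borel \<Longrightarrow> A \<inter> X = {} \<Longrightarrow> emeasure P A \<le> emeasure N A"
    using unsigned_Hahn_decomposition[of N P UNIV]
    by (auto simp: P.M_is_borel N.M_is_borel P.emeasure_finite N.emeasure_finite)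
  have pos: "0 \<le> \<nu> A" if "A \<in> sets borel" "A \<subseteq> X" for A
    using XP[OF that] by (simp add: \<nu> P.emeasure_eq_measure N.emeasure_eq_measure)
  have neg: "\<nu> A \<le> 0" if "A \<in> sets borel" "A \<inter> X = {}" for A
    using XN[OF that] by (simp add: \<nu> P.emeasure_eq_measure N.emeasure_eq_measure)
  note U = upper_variation_Hahn[OF sgn X pos neg]
  have V: "finite_borel_measure ?V"
    "\<And>A. A \<in> sets borel \<Longrightarrow> emeasure ?V A = ennreal (- \<nu> (A \<inter> - X))"
    using upper_variation_Hahn[OF finite_signed_measure_uminus[OF sgn], of "- X"] X pos neg
    by (force simp: disjoint_eq_subset_Compl)+
  have "add_measure ?U N = add_measure ?V P"
  proof (rule measure_eqI)
    fix A assume "A \<in> sets (add_measure ?U N)"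
    then have A: "A \<in> sets borel" by simp
    have "\<nu> (A \<inter> X) + \<nu> (A \<inter> - X) = \<nu> A"
      using finite_signed_measure_Un[OF sgn, of "A \<inter> X" "A \<inter> - X"] A X
      by (simp add: Int_Un_distrib[symmetric])
    then have "\<nu> (A \<inter> X) + measure N A = - \<nu> (A \<inter> - X) + measure P A"
      by (simp add: \<nu>)
    moreover have "0 \<le> \<nu> (A \<inter> X)" "0 \<le> - \<nu> (A \<inter> - X)"
      using A X pos[of "A \<inter> X"] neg[of "A \<inter> - X"] by auto
    ultimately show "emeasure (add_measure ?U N) A = emeasure (add_measure ?V P) A"
      by (simp add: emeasure_add_measure U V P N A P.emeasure_eq_measure N.emeasure_eq_measure
          ennreal_plus[symmetric] del: ennreal_plus)
  qed simp
  then have "(\<integral>x. f x \<partial>add_measure ?U N) = (\<integral>x. f x \<partial>add_measure ?V P)"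
    by (rule arg_cong)
  moreover have "integrable (add_measure ?U N) f" "integrable (add_measure ?V P) f"
    using f B by (auto intro!: finite_borel_measure.integrable_bounded
        finite_borel_measure_add_measure U(1) V(1) P N)
  ultimately have "(\<integral>x. f x \<partial>?U) + (\<integral>x. f x \<partial>N) = (\<integral>x. f x \<partial>?V) + (\<integral>x. f x \<partial>P)"
    using integral_add_measure[OF U(1) N, of f] integral_add_measure[OF V(1) P, of f] by metis
  then show ?thesis
    unfolding signed_integral_def by (metis add.commute add_diff_cancel_left' diff_diff_eq diff_add_eq)
qed


section \<open>Convolution\<close>

lemma finite_borel_measure_convolution:
  assumes "finite_borel_measure M" "finite_borel_measure N"
  shows "finite_borel_measure (M \<star> N)"
proof -
  interpret M: finite_borel_measure M by fact
  interpret N: finite_borel_measure N by fact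
  show ?thesis
    by (intro finite_borel_measure.intro finite_borel_measure_axioms.intro convolution_finite)
      (simp_all add: M.finite_measure_axioms N.finite_measure_axioms M.M_is_borel N.M_is_borel)
qed

lemma char_convolution:
  assumes "finite_borel_measure M" "finite_borel_measure N"
  shows "char (M \<star> N) t = char M t * char N t"
proof -
  interpret M: finite_borel_measure M by fact
  interpret N: finite_borel_measure N by fact
  interpret pair_sigma_finite M N ..
  interpret pair: finite_measure "M \<Otimes>\<^sub>M N"
    by (intro finite_measure_pair_measure M.finite_measure_axioms N.finite_measure_axioms)
  note [measurable_cong] = M.M_is_borel N.M_is_borel
  have "char (M \<star> N) t = (CLINT z|(M \<Otimes>\<^sub>M N). iexp (t * (fst z + snd z)))"
    unfolding char_def convolution_def by (subst integral_distr) (auto simp: split_beta)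
  also have "\<dots> = (\<integral>x. (\<integral>y. iexp (t * (x + y)) \<partial>N) \<partial>M)"
  proof (subst integral_fst'[symmetric])
    show "integrable (M \<Otimes>\<^sub>M N) (\<lambda>z. iexp (t * (fst z + snd z)))"
      by (rule pair.integrable_const_bound[where B = 1]) (auto simp del: of_real_mult of_real_add)
  qed simp
  also have "\<dots> = (\<integral>x. iexp (t * x) * (\<integral>y. iexp (t * y) \<partial>N) \<partial>M)"
    by (simp add: distrib_left exp_add)
  also have "\<dots> = char M t * char N t"
    by (simp add: char_def)
  finally show ?thesis .
qed

lemma char_add_measure:
  assumes "finite_borel_measure P" "finite_borel_measure N"
  shows "char (add_measure P N) t = char P t + char N t"
proof -
  interpret S: finite_borel_measure "add_measure P N"
    by (rule finite_borel_measure_add_measure[OF assms])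
  have "integrable (add_measure P N) (\<lambda>x. iexp (t * x))"
    by (rule S.integrable_bounded[where B = 1]) (auto simp del: of_real_mult)
  then show ?thesis
    unfolding char_def using integral_add_measure[OF assms] by blast
qed

lemma
  assumes "finite_borel_measure M" "finite_borel_measure N" and A[measurable]: "A \<in> sets borel"
  shows measurable_measure_translate: "(\<lambda>x. measure N {y. x + y \<in> A}) \<in> borel_measurable borel"
    and measure_convolution: "measure (M \<star> N) A = (\<integral>x. measure N {y. x + y \<in> A} \<partial>M)"
proof -
  interpret M: finite_borel_measure M by fact
  interpret N: finite_borel_measure N by fact
  interpret C: finite_borel_measure "M \<star> N"
    by (rule finite_borel_measure_convolution) fact+
  note [measurable_cong] = M.M_is_borel N.M_is_borel
  have "(\<lambda>x. measure N {y. x + y \<in> A}) = (\<lambda>x. \<integral>y. (indicator A (x + y) :: real) \<partial>N)"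
  proof
    fix x
    have "(\<lambda>y. indicator A (x + y)) = (indicator {y. x + y \<in> A} :: real \<Rightarrow> real)"
      by (auto split: split_indicator)
    then show "measure N {y. x + y \<in> A} = (\<integral>y. indicator A (x + y) \<partial>N)"
      by (simp add: N.borel_UNIV)
  qed
  moreover have "(\<lambda>x. \<integral>y. (indicator A (x + y) :: real) \<partial>N) \<in> borel_measurable (borel :: real measure)"
    by (rule N.borel_measurable_lebesgue_integral) measurable
  ultimately show meas: "(\<lambda>x. measure N {y. x + y \<in> A}) \<in> borel_measurable borel"
    by simp
  have "emeasure (M \<star> N) A = (\<integral>\<^sup>+x. emeasure N {y. y + x \<in> A} \<partial>M)"
    by (intro convolution_emeasure A)
      (simp_all add: M.finite_measure_axioms N.finite_measure_axioms M.M_is_borel N.M_is_borel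
        M.borel_UNIV N.borel_UNIV)
  also have "\<dots> = (\<integral>\<^sup>+x. ennreal (measure N {y. x + y \<in> A}) \<partial>M)"
    by (simp add: N.emeasure_eq_measure add.commute)
  also have "\<dots> = ennreal (\<integral>x. measure N {y. x + y \<in> A} \<partial>M)"
    by (intro nn_integral_eq_integral M.integrable_bounded[OF meas, of "measure N UNIV"])
      (auto simp: N.M_is_borel intro!: N.finite_measure_mono)
  finally show "measure (M \<star> N) A = (\<integral>x. measure N {y. x + y \<in> A} \<partial>M)"
    by (simp add: C.emeasure_eq_measure)
qed

text \<open>
  This is the expansion of \<open>(P - N) * (P' - N')\<close>, with the products of equal sign collected. Off the Borel
  sets both sides vanish, since a translate of a set that is not Borel is not Borel.
\<close>
lemma measure_difference_convolution:
  assumes \<nu>: "measure_difference \<nu> P N" and \<rho>: "measure_difference \<rho> P' N'"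
  shows "measure_difference (signed_convolution \<nu> \<rho>)
    (add_measure (P' \<star> P) (N' \<star> N)) (add_measure (P' \<star> N) (N' \<star> P))"
proof -
  have fin: "finite_borel_measure P" "finite_borel_measure N"
    "finite_borel_measure P'" "finite_borel_measure N'"
    and \<nu>_eq: "\<nu> = (\<lambda>A. measure P A - measure N A)"
    using \<nu> \<rho> by (auto simp: measure_difference_def)
  interpret P: finite_borel_measure P by fact
  interpret N: finite_borel_measure N by fact
  interpret P': finite_borel_measure P' by fact
  interpret N': finite_borel_measure N' by fact
  note conv = finite_borel_measure_convolution
  let ?S = "add_measure (P' \<star> P) (N' \<star> N)" and ?T = "add_measure (P' \<star> N) (N' \<star> P)"
  have "signed_convolution \<nu> \<rho> A = measure ?S A - measure ?T A" for A
  proof (cases "A \<in> sets borel")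
    case False
    have "{y. x + y \<in> A} \<notin> sets borel" for x
    proof
      assume "{y. x + y \<in> A} \<in> sets borel"
      moreover have "(\<lambda>y. y - x) \<in> borel_measurable borel" by simp
      ultimately have "(\<lambda>y. y - x) -` {y. x + y \<in> A} \<inter> space borel \<in> sets borel"
        by (rule measurable_sets[rotated])
      then show False using False by simp
    qed
    then have "signed_convolution \<nu> \<rho> A = 0"
      by (simp add: signed_convolution_def signed_integral_def \<nu>_eq measure_notin_sets
          P.M_is_borel N.M_is_borel)
    then show ?thesis using False by (simp add: measure_notin_sets)
  next
    case True
    note meas = measurable_measure_translate[OF fin(1) fin(1) True]
      measurable_measure_translate[OF fin(1) fin(2) True]
    have le: "measure P {y. x + y \<in> A} \<le> measure P UNIV"
      "measure N {y. x + y \<in> A} \<le> measure N UNIV" for x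
      by (auto intro!: P.finite_measure_mono N.finite_measure_mono simp: P.M_is_borel N.M_is_borel)
    have int: "integrable M (\<lambda>x. measure P {y. x + y \<in> A})"
      "integrable M (\<lambda>x. measure N {y. x + y \<in> A})" if "M = P' \<or> M = N'" for M
      using that fin(3,4) meas le
      by (auto intro!: finite_borel_measure.integrable_bounded)
    have "signed_convolution \<nu> \<rho> A =
      (\<integral>x. measure P {y. x + y \<in> A} - measure N {y. x + y \<in> A} \<partial>P') -
      (\<integral>x. measure P {y. x + y \<in> A} - measure N {y. x + y \<in> A} \<partial>N')"
      unfolding signed_convolution_def \<nu>_eq
    proof (rule signed_integral_difference[OF \<rho>, where B = "measure P UNIV + measure N UNIV"])
      fix x
      show "norm (measure P {y. x + y \<in> A} - measure N {y. x + y \<in> A})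
        \<le> measure P UNIV + measure N UNIV"
        using le[of x] measure_nonneg[of P "{y. x + y \<in> A}"] measure_nonneg[of N "{y. x + y \<in> A}"]
        unfolding real_norm_def abs_le_iff by linarith
    qed (use meas in auto)
    also have "\<dots> = measure (P' \<star> P) A - measure (P' \<star> N) A -
        (measure (N' \<star> P) A - measure (N' \<star> N) A)"
      using int by (simp add: measure_convolution fin True)
    also have "\<dots> = measure ?S A - measure ?T A"
      by (simp add: measure_add_measure conv fin True)
    finally show ?thesis .
  qed
  then show ?thesis
    unfolding measure_difference_def
    by (intro conjI ext finite_borel_measure_add_measure conv fin)
qed

section \<open>Fourier-Stieltjes transforms of signed measures\<close>

text \<open>
  Hiding \<open>P\<close> and \<open>N\<close> leaves a calculus in which signed measures and their transforms are added and
  multiplied together.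
\<close>
definition has_transform :: "(real set \<Rightarrow> real) \<Rightarrow> (real \<Rightarrow> complex) \<Rightarrow> bool" where
  "has_transform \<nu> \<phi> \<longleftrightarrow> (\<exists>P N. measure_difference \<nu> P N \<and> (\<forall>t. \<phi> t = char P t - char N t))"

lemma has_transform_signed_measure:
  "has_transform \<nu> \<phi> \<Longrightarrow> finite_signed_measure \<nu>"
  by (auto simp: has_transform_def intro: finite_signed_measure_difference)

text \<open>The transform in the predicate is the one defined by the Jordan decomposition.\<close>
lemma has_transform_signed_integral:
  assumes "has_transform \<nu> \<phi>"
  shows "signed_integral \<nu> (\<lambda>x. iexp (t * x)) = \<phi> t"
proof -
  obtain P N where diff: "measure_difference \<nu> P N" and \<phi>: "\<phi> t = char P t - char N t"
    using assms by (auto simp: has_transform_def)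
  show ?thesis
    unfolding \<phi> char_def
    by (rule signed_integral_difference[OF diff, where B = 1]) (auto simp del: of_real_mult)
qed

lemma has_transform_diff:
  assumes "finite_borel_measure P" "finite_borel_measure N"
  shows "has_transform (\<lambda>A. measure P A - measure N A) (\<lambda>t. char P t - char N t)"
  using assms by (auto simp: has_transform_def measure_difference_def)

lemma has_transform_measure:
  assumes "finite_borel_measure P"
  shows "has_transform (measure P) (char P)"
proof -
  have "finite_borel_measure (null_measure borel)"
    by (rule finite_borel_measureI) simp_all
  moreover have "char (null_measure borel) = (\<lambda>t. 0)"
    by (simp add: char_def fun_eq_iff)
  ultimately show ?thesis
    using has_transform_diff[OF assms, of "null_measure borel"] by simp
qed

lemma has_transform_add:
  assumes "has_transform \<nu> \<phi>" "has_transform \<rho> \<psi>"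
  shows "has_transform (\<lambda>A. \<nu> A + \<rho> A) (\<lambda>t. \<phi> t + \<psi> t)"
proof -
  obtain P N P' N' where "measure_difference \<nu> P N" "measure_difference \<rho> P' N'"
    and \<phi>: "\<And>t. \<phi> t = char P t - char N t" "\<And>t. \<psi> t = char P' t - char N' t"
    using assms by (auto simp: has_transform_def)
  then have fin: "finite_borel_measure P" "finite_borel_measure N"
    "finite_borel_measure P'" "finite_borel_measure N'"
    and eq: "\<nu> = (\<lambda>A. measure P A - measure N A)" "\<rho> = (\<lambda>A. measure P' A - measure N' A)"
    by (auto simp: measure_difference_def)
  interpret P: finite_borel_measure P by fact
  interpret N: finite_borel_measure N by fact
  interpret P': finite_borel_measure P' by fact
  interpret N': finite_borel_measure N' by fact
  have "\<nu> A + \<rho> A = measure (add_measure P P') A - measure (add_measure N N') A" for A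
    by (cases "A \<in> sets borel")
      (simp_all add: eq measure_add_measure fin measure_notin_sets
        P.M_is_borel N.M_is_borel P'.M_is_borel N'.M_is_borel)
  then show ?thesis
    unfolding has_transform_def measure_difference_def
    by (intro exI[of _ "add_measure P P'"] exI[of _ "add_measure N N'"])
      (auto simp: fin finite_borel_measure_add_measure char_add_measure \<phi>)
qed

lemma has_transform_convolution:
  assumes "has_transform \<nu> \<phi>" "has_transform \<rho> \<psi>"
  shows "has_transform (signed_convolution \<nu> \<rho>) (\<lambda>t. \<phi> t * \<psi> t)"
proof -
  obtain P N P' N' where diff: "measure_difference \<nu> P N" "measure_difference \<rho> P' N'"
    and \<phi>: "\<And>t. \<phi> t = char P t - char N t" "\<And>t. \<psi> t = char P' t - char N' t"
    using assms by (auto simp: has_transform_def)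
  then have fin: "finite_borel_measure P" "finite_borel_measure N"
    "finite_borel_measure P'" "finite_borel_measure N'"
    by (auto simp: measure_difference_def)
  have "\<phi> t * \<psi> t = char (add_measure (P' \<star> P) (N' \<star> N)) t -
      char (add_measure (P' \<star> N) (N' \<star> P)) t" for t
    by (simp add: \<phi> fin char_add_measure char_convolution finite_borel_measure_convolution
        algebra_simps)
  then show ?thesis
    unfolding has_transform_def using measure_difference_convolution[OF diff] by blast
qed

lemma char_dirac_zero: "char (return borel 0) t = 1"
  unfolding char_def by (subst integral_return) auto

lemma finite_borel_measure_dirac: "finite_borel_measure (return borel x)"
  by (rule finite_borel_measureI) simp_all

lemma has_transform_convolution_power:
  assumes "has_transform \<nu> \<phi>"
  shows "has_transform (convolution_power \<nu> l) (\<lambda>t. \<phi> t ^ l)"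
proof (induction l)
  case 0
  have "char (return borel 0) = (\<lambda>t. 1)"
    by (simp add: fun_eq_iff char_dirac_zero)
  then show ?case
    using has_transform_measure[OF finite_borel_measure_dirac[of 0]] by simp
next
  case (Suc l)
  then show ?case using has_transform_convolution[OF assms Suc] by simp
qed

lemma has_transform_deconvolution_kernel:
  assumes "has_transform (delta_minus \<mu>s) \<phi>"
  shows "\<exists>\<kappa>. has_transform \<kappa> (\<lambda>t. \<Sum>l\<le>m. \<phi> t ^ l) \<and>
    signed_cdf \<kappa> = (\<lambda>x. deconvolution_kernel \<mu>s x m)"
proof (intro exI conjI)
  let ?p = "convolution_power (delta_minus \<mu>s)"
  show "has_transform (\<lambda>A. \<Sum>l\<le>m. ?p l A) (\<lambda>t. \<Sum>l\<le>m. \<phi> t ^ l)"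
  proof (induction m)
    case 0
    show ?case using has_transform_convolution_power[OF assms, of 0] by simp
  next
    case (Suc m)
    show ?case
      using has_transform_add[OF Suc has_transform_convolution_power[OF assms, of "Suc m"]]
      by simp
  qed
qed (simp add: signed_cdf_def deconvolution_kernel_def fun_eq_iff)

text \<open>
  The integrals that define the deconvolution function are the values of a signed convolution on the rays,
  because \<open>x + y \<le> \<xi>\<close> means \<open>y \<le> \<xi> - x\<close>. Uniqueness of the measure with a given distribution function
  then identifies the Stieltjes integrals, first for the kernel and then for the deconvolution function.
  The rest is the finite geometric sum.
\<close>
lemma deconvolution_transform_eq:
  assumes chi: "real_distribution chi" and \<mu>s: "real_distribution \<mu>s"
  shows "deconvolution_transform chi \<mu>s t m =
    char chi t * (1 - (1 - char \<mu>s t) ^ Suc m)"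
proof -
  interpret chi: real_distribution chi by fact
  interpret \<mu>s: real_distribution \<mu>s by fact
  note fin = chi.finite_borel_measure_M \<mu>s.finite_borel_measure_M
  have "has_transform (delta_minus \<mu>s) (\<lambda>t. 1 - char \<mu>s t)"
    using has_transform_diff[OF finite_borel_measure_dirac[of 0] fin(2)]
    by (simp add: char_dirac_zero delta_minus_def[abs_def])
  from has_transform_deconvolution_kernel[OF this, of m]
  obtain \<kappa> where \<kappa>: "has_transform \<kappa> (\<lambda>t. \<Sum>l\<le>m. (1 - char \<mu>s t) ^ l)"
    and kernel: "signed_cdf \<kappa> = (\<lambda>x. deconvolution_kernel \<mu>s x m)"
    by blast
  let ?\<delta> = "signed_convolution (measure (chi \<star> \<mu>s)) \<kappa>"
  have \<delta>: "has_transform ?\<delta> (\<lambda>t. char chi t * char \<mu>s t * (\<Sum>l\<le>m. (1 - char \<mu>s t) ^ l))"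
    using has_transform_convolution[OF
        has_transform_measure[OF finite_borel_measure_convolution[OF fin]] \<kappa>]
    by (simp add: char_convolution fin)
  have "deconvolution_function chi \<mu>s \<xi> m = signed_cdf ?\<delta> \<xi>" for \<xi>
  proof -
    have "{y. x + y \<in> {..\<xi>}} = {..\<xi> - x}" for x by auto
    then show ?thesis
      unfolding deconvolution_function_def stieltjes_integral_def kernel[symmetric]
        stieltjes_measure_signed_cdf[OF has_transform_signed_measure[OF \<kappa>]]
      by (simp add: signed_cdf_def signed_convolution_def cdf_def)
  qed
  then have "deconvolution_transform chi \<mu>s t m = signed_integral ?\<delta> (\<lambda>x. iexp (t * x))"
    unfolding deconvolution_transform_def stieltjes_integral_def
    by (simp add: stieltjes_measure_signed_cdf[OF has_transform_signed_measure[OF \<delta>]])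
  also have "\<dots> = char chi t * (char \<mu>s t * (\<Sum>l\<le>m. (1 - char \<mu>s t) ^ l))"
    unfolding has_transform_signed_integral[OF \<delta>] by (simp only: mult.assoc)
  also have "char \<mu>s t * (\<Sum>l\<le>m. (1 - char \<mu>s t) ^ l) = 1 - (1 - char \<mu>s t) ^ Suc m"
    using sum_gp_basic[of "1 - char \<mu>s t" m] by simp
  finally show ?thesis .
qed

section \<open>Convergence\<close>

text \<open>
  The error is \<open>\<bar>u t\<bar> (1 - v t)\<^sup>m\<^sup>+\<^sup>1\<close>. The first factor makes it small off the compact set \<open>K\<close> of points
  with \<open>e \<le> \<bar>u t\<bar>\<close>; on \<open>K\<close> the function \<open>v\<close> is positive, hence bounded away from 0, and the second
  factor decays geometrically.
\<close>
lemma uniform_limit_mult_one_minus_power: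
  fixes u :: "real \<Rightarrow> complex" and v :: "real \<Rightarrow> real"
  assumes S: "closed S" and u: "continuous_on S u" and v: "continuous_on S v"
    and u1: "\<And>t. t \<in> S \<Longrightarrow> cmod (u t) \<le> 1" and v01: "\<And>t. t \<in> S \<Longrightarrow> v t \<in> {0..1}"
    and zero: "\<And>t. t \<in> S \<Longrightarrow> v t = 0 \<Longrightarrow> u t = 0"
    and bdd: "\<And>e. e > 0 \<Longrightarrow> bounded {t \<in> S. e \<le> cmod (u t)}"
  shows "uniform_limit S (\<lambda>m t. u t * (1 - (1 - of_real (v t)) ^ Suc m)) u sequentially"
proof (rule uniform_limitI)
  fix e :: real assume e: "e > 0"
  define K where "K = {t \<in> S. e \<le> cmod (u t)}"
  have "closed K"
    unfolding K_def
    using continuous_closed_preimage[OF continuous_on_norm[OF u] S, of "{e..}"]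
    by (simp add: vimage_def Int_def conj_commute)
  then have K: "compact K"
    using bdd[OF e] by (simp add: K_def compact_eq_bounded_closed)
  \<comment> \<open>The witness 1 for empty \<open>K\<close> only keeps \<open>1 - \<delta>\<close> inside the unit interval.\<close>
  have "\<exists>\<delta>>0. \<delta> \<le> 1 \<and> (\<forall>t\<in>K. \<delta> \<le> v t)"
  proof (cases "K = {}")
    case True
    then show ?thesis by (intro exI[of _ 1]) auto
  next
    case False
    have "continuous_on K v" using v by (rule continuous_on_subset) (auto simp: K_def)
    from continuous_attains_inf[OF K False this]
    obtain t where t: "t \<in> K" "\<forall>s\<in>K. v t \<le> v s" by blast
    then have "v t \<noteq> 0" using zero[of t] e by (auto simp: K_def)
    then show ?thesis using t v01[of t] by (intro exI[of _ "v t"]) (auto simp: K_def)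
  qed
  then obtain \<delta> where \<delta>: "\<delta> > 0" "\<delta> \<le> 1" "\<And>t. t \<in> K \<Longrightarrow> \<delta> \<le> v t" by blast
  have "(\<lambda>m. (1 - \<delta>) ^ Suc m) \<longlonglongrightarrow> 0"
    using \<delta> by (intro LIMSEQ_Suc LIMSEQ_power_zero) auto
  then have "\<forall>\<^sub>F m in sequentially. (1 - \<delta>) ^ Suc m < e"
    using e by (rule order_tendstoD)
  then show "\<forall>\<^sub>F m in sequentially. \<forall>t\<in>S.
    dist (u t * (1 - (1 - of_real (v t)) ^ Suc m)) (u t) < e"
  proof eventually_elim
    case (elim m)
    show ?case
    proof
      fix t assume t: "t \<in> S"
      have "dist (u t * (1 - (1 - of_real (v t)) ^ Suc m)) (u t) =
          cmod (u t * of_real ((1 - v t) ^ Suc m))"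
        by (simp add: dist_norm right_diff_distrib norm_minus_commute del: power_Suc)
      also have "\<dots> = cmod (u t) * (1 - v t) ^ Suc m"
        using v01[OF t] by (simp add: norm_mult norm_power del: power_Suc of_real_power of_real_diff)
      also have "\<dots> < e"
      proof (cases "t \<in> K")
        case True
        have "cmod (u t) * (1 - v t) ^ Suc m \<le> 1 * (1 - \<delta>) ^ Suc m"
          using u1[OF t] v01[OF t] \<delta>(3)[OF True] by (intro mult_mono power_mono) auto
        then show ?thesis using elim by simp
      next
        case False
        then have "cmod (u t) < e" using t by (auto simp: K_def)
        moreover have "cmod (u t) * (1 - v t) ^ Suc m \<le> cmod (u t) * 1"
          using v01[OF t] by (intro mult_left_mono power_le_one) auto
        ultimately show ?thesis by simp
      qed
      finally show "dist (u t * (1 - (1 - of_real (v t)) ^ Suc m)) (u t) < e" .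
    qed
  qed
qed

lemma bounded_superlevel_set:
  fixes u :: "real \<Rightarrow> complex"
  assumes top: "(u \<longlongrightarrow> 0) at_top" and bot: "(u \<longlongrightarrow> 0) at_bot" and e: "e > 0"
  shows "bounded {t. e \<le> cmod (u t)}"
proof -
  have "\<forall>\<^sub>F t in at_top. cmod (u t) < e" "\<forall>\<^sub>F t in at_bot. cmod (u t) < e"
    using tendstoD[OF top e] tendstoD[OF bot e] by simp_all
  then obtain a b where "\<And>t. t \<ge> b \<Longrightarrow> cmod (u t) < e" "\<And>t. t \<le> a \<Longrightarrow> cmod (u t) < e"
    by (auto simp: eventually_at_top_linorder eventually_at_bot_linorder)
  then have "{t. e \<le> cmod (u t)} \<subseteq> {a..b}"
    by (force simp: not_less[symmetric])
  then show ?thesis by (rule bounded_subset[OF bounded_closed_interval])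
qed

lemma sup_norm_le:
  assumes "\<And>t. cmod (f t) \<le> c"
  shows "sup_norm f \<le> ereal c"
  unfolding sup_norm_def using assms by (intro SUP_least) simp

lemma sup_norm_tendsto_zero:
  assumes "uniform_limit UNIV f g sequentially"
  shows "(\<lambda>m. sup_norm (\<lambda>t. f m t - g t)) \<longlonglongrightarrow> 0"
proof (rule order_tendstoI)
  fix a :: ereal assume "a < 0"
  moreover have "0 \<le> sup_norm h" for h
    unfolding sup_norm_def by (rule SUP_upper2[of 0]) simp_all
  ultimately show "\<forall>\<^sub>F m in sequentially. a < sup_norm (\<lambda>t. f m t - g t)"
    by (intro always_eventually allI) (rule less_le_trans)
next
  fix a :: ereal assume "0 < a"
  then obtain e where e: "0 < ereal e" "ereal e < a" by (metis ereal_dense2)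
  from uniform_limitD[OF assms, of e] e(1)
  have "\<forall>\<^sub>F m in sequentially. \<forall>t. dist (f m t) (g t) < e" by simp
  then show "\<forall>\<^sub>F m in sequentially. sup_norm (\<lambda>t. f m t - g t) < a"
  proof eventually_elim
    case (elim m)
    then have "sup_norm (\<lambda>t. f m t - g t) \<le> ereal e"
      by (intro sup_norm_le) (auto simp: dist_norm less_imp_le)
    then show ?case using e(2) by (rule le_less_trans)
  qed
qed

theorem theorem3p1:
  fixes chi \<mu> \<mu>s :: "real measure"
  assumes "real_distribution chi"
    and "real_distribution \<mu>"
    and "symmetrization \<mu> \<mu>s"
  shows "(\<forall>m. sup_norm (\<lambda>t. deconvolution_transform chi \<mu>s t m) \<le> 1) \<and>
         (\<forall>t :: real. ereal t \<notin> char_zeros \<mu> \<or> ereal t \<in> char_zeros \<mu> \<inter> char_zeros chi \<longrightarrow>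
            (\<lambda>m. cmod (deconvolution_transform chi \<mu>s t m - char chi t)) \<longlonglongrightarrow> 0) \<and>
         (\<forall>a b :: real. ereal ` {a..b} \<inter> char_zeros \<mu> \<subseteq> char_zeros chi \<longrightarrow>
            uniform_limit {a..b} (\<lambda>m t. deconvolution_transform chi \<mu>s t m) (char chi) sequentially) \<and>
         (char_zeros \<mu> \<subseteq> char_zeros chi \<and> \<infinity> \<in> char_zeros chi \<and> -\<infinity> \<in> char_zeros chi \<longrightarrow>
            (\<lambda>m. sup_norm (\<lambda>t. deconvolution_transform chi \<mu>s t m - char chi t)) \<longlonglongrightarrow> 0)"
proof -
  have \<mu>s: "real_distribution \<mu>s" and zeros: "char_zeros \<mu>s = char_zeros \<mu>"
    and "\<forall>t. \<exists>r. char \<mu>s t = complex_of_real r \<and> 0 \<le> r \<and> r \<le> 1"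
    using assms(3) by (auto simp: symmetrization_def)
  then obtain v where v: "\<And>t. char \<mu>s t = complex_of_real (v t)" "\<And>t. v t \<in> {0..1}"
    by (metis atLeastAtMost_iff)
  interpret chi: real_distribution chi by fact
  interpret \<mu>s: real_distribution \<mu>s by fact
  have eq: "deconvolution_transform chi \<mu>s t m = char chi t * (1 - (1 - of_real (v t)) ^ Suc m)"
    for t m
    by (simp add: deconvolution_transform_eq[OF assms(1) \<mu>s] v(1))
  have finite_zero: "ereal t \<in> char_zeros M \<longleftrightarrow> char M t = 0" for t M
    by (auto simp: char_zeros_def)
  have v_zero: "ereal t \<in> char_zeros \<mu> \<longleftrightarrow> v t = 0" for t
    by (simp add: zeros[symmetric] finite_zero v(1))
  have cont_v: "continuous_on S v" for S
  proof -
    have "continuous_on S (\<lambda>t. Re (char \<mu>s t))"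
      by (intro continuous_on_Re continuous_at_imp_continuous_on ballI \<mu>s.isCont_char)
    then show ?thesis by (simp add: v(1))
  qed
  have conv: "uniform_limit S (\<lambda>m t. deconvolution_transform chi \<mu>s t m) (char chi) sequentially"
    if "closed S" "\<And>t. t \<in> S \<Longrightarrow> ereal t \<in> char_zeros \<mu> \<Longrightarrow> ereal t \<in> char_zeros chi"
      "\<And>e. e > 0 \<Longrightarrow> bounded {t \<in> S. e \<le> cmod (char chi t)}" for S
    unfolding eq
  proof (rule uniform_limit_mult_one_minus_power[OF that(1) _ cont_v])
    show "continuous_on S (char chi)"
      by (intro continuous_at_imp_continuous_on ballI chi.isCont_char)
    show "char chi t = 0" if "t \<in> S" "v t = 0" for t
      using that \<open>\<And>t. t \<in> S \<Longrightarrow> ereal t \<in> char_zeros \<mu> \<Longrightarrow> ereal t \<in> char_zeros chi\<close>[of t]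
      by (simp add: v_zero finite_zero[of t chi])
  qed (use that(3) v(2) chi.cmod_char_le_1 in auto)
  have "cmod (deconvolution_transform chi \<mu>s t m) \<le> 1" for t m
  proof -
    have "cmod (deconvolution_transform chi \<mu>s t m) = cmod (char chi t) * cmod (of_real (1 - (1 - v t) ^ Suc m))"
      by (simp add: eq norm_mult)
    also have "\<dots> \<le> 1 * 1"
      using v(2)[of t] power_le_one[of "1 - v t" "Suc m"] zero_le_power[of "1 - v t" "Suc m"]
      by (intro mult_mono chi.cmod_char_le_1) (simp_all del: of_real_diff of_real_power power_Suc)
    finally show ?thesis by simp
  qed
  then have part0: "sup_norm (\<lambda>t. deconvolution_transform chi \<mu>s t m) \<le> 1" for m
    using sup_norm_le[of _ 1] by (simp add: one_ereal_def)
  have part1: "(\<lambda>m. cmod (deconvolution_transform chi \<mu>s t m - char chi t)) \<longlonglongrightarrow> 0"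
    if "ereal t \<notin> char_zeros \<mu> \<or> ereal t \<in> char_zeros \<mu> \<inter> char_zeros chi" for t
  proof -
    have "uniform_limit {t} (\<lambda>m t. deconvolution_transform chi \<mu>s t m) (char chi) sequentially"
      using that by (intro conv) (auto intro: bounded_subset[of "{t}"])
    then have "(\<lambda>m. deconvolution_transform chi \<mu>s t m) \<longlonglongrightarrow> char chi t"
      by (rule tendsto_uniform_limitI) simp
    then show ?thesis
      by (intro tendsto_norm_zero) (simp add: LIM_zero)
  qed
  have part2: "uniform_limit {a..b} (\<lambda>m t. deconvolution_transform chi \<mu>s t m) (char chi) sequentially"
    if "ereal ` {a..b} \<inter> char_zeros \<mu> \<subseteq> char_zeros chi" for a b
    using that by (intro conv) (auto intro: bounded_subset[OF bounded_closed_interval[of a b]])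
  have part3: "(\<lambda>m. sup_norm (\<lambda>t. deconvolution_transform chi \<mu>s t m - char chi t)) \<longlonglongrightarrow> 0"
    if "char_zeros \<mu> \<subseteq> char_zeros chi" "\<infinity> \<in> char_zeros chi" "-\<infinity> \<in> char_zeros chi"
  proof (rule sup_norm_tendsto_zero, rule conv)
    fix e :: real assume "e > 0"
    moreover have "(char chi \<longlongrightarrow> 0) at_top" "(char chi \<longlongrightarrow> 0) at_bot"
      using that(2,3) by (auto simp: char_zeros_def)
    ultimately show "bounded {t \<in> UNIV. e \<le> cmod (char chi t)}"
      using bounded_superlevel_set[of "char chi" e] by simp
  qed (use that in auto)
  show ?thesis using part0 part1 part2 part3 by blast
qed

end
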